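(* Let $m,n$ be positive integers and let $F$ be a field whose characteristic is zero or coprime to $n$. Let $g(X)$ be a polynomial over $F$ with $\deg g(X)<n$, and let $r=\min\big\{m,\;n-\deg\gcd\big(g(X),X^n-1\big)\big\}$, which is the rank of $M(g)_{m\times n}$. Then any consecutive $r$ rows of $M(g)_{m\times n}$ are linearly independent.
   Context: For a polynomial $g(X)=\sum_{j=0}^{n-1}g_jX^j$ over $F$ of degree less than $n$, the generalized circulant matrix $M(g)_{m\times n}$ is the $m\times n$ matrix over $F$ whose $i$-th row ($i=0,1,\dots,m-1$, rows counted from $0$) is $\mathcal S^i(g_0,g_1,\dots,g_{n-1})$, where $\mathcal S(a_0,a_1,\dots,a_{n-1})=(a_{n-1},a_0,\dots,a_{n-2})$ is the circular shift on $F^n$. Equivalently, its $(i,j)$ entry ($0\le i<m$, $0\le j<n$) is $g_{(j-i)\bmod n}$. Here $\gcd$ of polynomials is the greatest common divisor in $F[X]$ (with $\gcd(0,f)=f$). "Consecutive $r$ rows" means rows $i,i+1,\dots,i+r-1$ for some $i$ with $0\le i\le m-r$. *)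

theory Defs
  imports
    "Jordan_Normal_Form.DL_Rank"
    "HOL-Computational_Algebra.Polynomial_Factorial"
begin

definition circ_shift :: "'a vec \<Rightarrow> 'a vec" where
  "circ_shift v =
     vec (dim_vec v) (\<lambda>j. if j = 0 then v $ (dim_vec v - 1) else v $ (j - 1))"

definition gen_circulant :: "nat \<Rightarrow> nat \<Rightarrow> 'a::zero poly \<Rightarrow> 'a mat" where
  "gen_circulant m n g = mat_of_rows n (map (\<lambda>i. (circ_shift ^^ i) (vec n (coeff g))) [0..<m])"

text \<open>The library's \<^const>\<open>gcd\<close> on polynomials needs the coefficient type to be of class
  \<^class>\<open>field_gcd\<close>. The following is the monic greatest common divisor over an arbitrary
  \<^class>\<open>field\<close>; it is well defined (see \<open>is_poly_gcd_poly_gcd\<close>) and agrees with the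
  library's \<^const>\<open>gcd\<close> where the latter is available (see \<open>poly_gcd_eq_gcd\<close>).\<close>

definition is_poly_gcd :: "'a::field poly \<Rightarrow> 'a poly \<Rightarrow> 'a poly \<Rightarrow> bool" where
  "is_poly_gcd p q d \<longleftrightarrow>
     d dvd p \<and> d dvd q \<and> (\<forall>e. e dvd p \<longrightarrow> e dvd q \<longrightarrow> e dvd d) \<and> (d = 0 \<or> lead_coeff d = 1)"

definition poly_gcd :: "'a::field poly \<Rightarrow> 'a poly \<Rightarrow> 'a poly" where
  "poly_gcd p q = (THE d. is_poly_gcd p q d)"

lemma is_poly_gcd_unique:
  assumes "is_poly_gcd p q d" "is_poly_gcd p q e"
  shows "d = e"
proof -
  have de: "d dvd e" and ed: "e dvd d"
    using assms by (simp_all add: is_poly_gcd_def)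
  show ?thesis
  proof (cases "d = 0")
    case True
    then show ?thesis using de by simp
  next
    case False
    then have "e \<noteq> 0" using ed by auto
    from de obtain k where k: "e = d * k" ..
    with \<open>e \<noteq> 0\<close> have "degree e = degree d + degree k"
      by (simp add: degree_mult_eq)
    moreover have "degree e \<le> degree d"
      using ed False by (rule dvd_imp_degree_le)
    ultimately have "degree k = 0" by simp
    then obtain c where c: "k = [:c:]" by (rule degree_eq_zeroE)
    have "lead_coeff d = 1" "lead_coeff e = 1"
      using assms False \<open>e \<noteq> 0\<close> by (auto simp: is_poly_gcd_def)
    then have "lead_coeff k = 1"
      unfolding k by (simp add: lead_coeff_mult)
    then show ?thesis using k c by simp
  qed
qed

lemma is_poly_gcd_0_right: "\<exists>d. is_poly_gcd p 0 d" for p :: "'a::field poly"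
proof (cases "p = 0")
  case True
  then have "is_poly_gcd p 0 0" by (simp add: is_poly_gcd_def)
  then show ?thesis ..
next
  case False
  then have "inverse (lead_coeff p) \<noteq> 0" by simp
  then have "Polynomial.smult (inverse (lead_coeff p)) p dvd p"
    by (intro smult_dvd dvd_refl)
  moreover have "lead_coeff (Polynomial.smult (inverse (lead_coeff p)) p) = 1"
    using False by (simp only: lead_coeff_smult) simp
  ultimately have "is_poly_gcd p 0 (Polynomial.smult (inverse (lead_coeff p)) p)"
    unfolding is_poly_gcd_def by (blast intro: dvd_smult)
  then show ?thesis ..
qed

lemma is_poly_gcd_exists: "\<exists>d. is_poly_gcd p q d" for p q :: "'a::field poly"
proof (induction "if q = 0 then 0 else Suc (degree q)" arbitrary: p q rule: less_induct)
  case less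
  show ?case
  proof (cases "q = 0")
    case True
    then show ?thesis using is_poly_gcd_0_right by simp
  next
    case False
    then have "p mod q = 0 \<or> degree (p mod q) < degree q"
      using degree_mod_less by blast
    with False have "(if p mod q = 0 then 0 else Suc (degree (p mod q)))
        < (if q = 0 then 0 else Suc (degree q))"
      by auto
    then obtain d where d: "is_poly_gcd q (p mod q) d"
      using less by blast
    have "e dvd q \<Longrightarrow> e dvd p mod q \<longleftrightarrow> e dvd p" for e
      by (rule dvd_mod_iff)
    with d have "is_poly_gcd p q d"
      unfolding is_poly_gcd_def by blast
    then show ?thesis ..
  qed
qed

lemma is_poly_gcd_poly_gcd: "is_poly_gcd p q (poly_gcd p q)"
  unfolding poly_gcd_def
proof (rule theI')
  obtain d where "is_poly_gcd p q d"
    using is_poly_gcd_exists by blast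
  then show "\<exists>!d. is_poly_gcd p q d"
    by (rule ex1I) (rule is_poly_gcd_unique[OF _ \<open>is_poly_gcd p q d\<close>])
qed

lemma poly_gcd_eq_gcd: "poly_gcd p q = gcd p q" for p q :: "'a::field_gcd poly"
proof -
  have "lead_coeff (gcd p q) = 1" if "gcd p q \<noteq> 0"
  proof -
    have "unit_factor (gcd p q) = 1" using that by (simp add: unit_factor_gcd)
    then have "unit_factor (lead_coeff (gcd p q)) = 1"
      by (simp add: unit_factor_poly_def one_pCons)
    then show ?thesis
      using that by (metis dvd_field_iff is_unit_unit_factor leading_coeff_0_iff)
  qed
  then have "is_poly_gcd p q (gcd p q)"
    unfolding is_poly_gcd_def by auto
  then show ?thesis
    using is_poly_gcd_poly_gcd is_poly_gcd_unique by blast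
qed

lemma circ_shift_index:
  assumes "j < dim_vec v"
  shows "circ_shift v $ j = (if j = 0 then v $ (dim_vec v - 1) else v $ (j - 1))"
  using assms unfolding circ_shift_def by (rule index_vec)

lemma dim_circ_shift: "dim_vec (circ_shift v) = dim_vec v"
  unfolding circ_shift_def by (rule dim_vec)

lemma dim_circ_shift_pow: "dim_vec ((circ_shift ^^ i) v) = dim_vec v"
  by (induction i) (simp_all add: dim_circ_shift)

lemma circ_shift_pow_index:
  assumes "j < n"
  shows "(circ_shift ^^ i) (vec n f) $ j = f (nat ((int j - int i) mod int n))"
  using assms
proof (induction i arbitrary: j)
  case 0
  then show ?case by simp
next
  case (Suc i)
  show ?case
  proof (cases "j = 0")
    case True
    have "(int (n - 1) - int i) mod int n = (int n + (int j - int (Suc i))) mod int n"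
      using Suc.prems True by (intro arg_cong[where f = "\<lambda>x. x mod int n"]) linarith
    also have "\<dots> = (int j - int (Suc i)) mod int n"
      by (rule mod_add_self1)
    finally have eq: "(int (n - 1) - int i) mod int n = (int j - int (Suc i)) mod int n" .
    have "n - 1 < n" using Suc.prems by linarith
    have "(circ_shift ^^ Suc i) (vec n f) $ j = (circ_shift ^^ i) (vec n f) $ (n - 1)"
      using Suc.prems True by (simp add: circ_shift_index dim_circ_shift_pow del: index_vec)
    also have "\<dots> = f (nat ((int j - int (Suc i)) mod int n))"
      unfolding Suc.IH[OF \<open>n - 1 < n\<close>] eq ..
    finally show ?thesis .
  next
    case False
    then have eq: "int (j - 1) - int i = int j - int (Suc i)" by linarith
    have "j - 1 < n" using Suc.prems by linarith
    have "(circ_shift ^^ Suc i) (vec n f) $ j = (circ_shift ^^ i) (vec n f) $ (j - 1)"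
      using Suc.prems False by (simp add: circ_shift_index dim_circ_shift_pow del: index_vec)
    also have "\<dots> = f (nat ((int j - int (Suc i)) mod int n))"
      unfolding Suc.IH[OF \<open>j - 1 < n\<close>] eq ..
    finally show ?thesis .
  qed
qed

lemma gen_circulant_carrier: "gen_circulant m n g \<in> carrier_mat m n"
proof (rule carrier_matI)
  show "dim_row (gen_circulant m n g) = m" "dim_col (gen_circulant m n g) = n"
    unfolding gen_circulant_def mat_of_rows_def dim_row_mat dim_col_mat by simp_all
qed

lemma gen_circulant_index:
  assumes "i < m" "j < n"
  shows "gen_circulant m n g $$ (i, j) = coeff g (nat ((int j - int i) mod int n))"
proof -
  let ?rs = "map (\<lambda>i. (circ_shift ^^ i) (vec n (coeff g))) [0..<m]"
  have "i < length ?rs" using assms by simp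
  then have "gen_circulant m n g $$ (i, j) = ?rs ! i $ j"
    unfolding gen_circulant_def using assms(2) by (rule mat_of_rows_index)
  also have "?rs ! i = (circ_shift ^^ i) (vec n (coeff g))"
    using assms(1) by simp
  also have "\<dots> $ j = coeff g (nat ((int j - int i) mod int n))"
    using assms(2) by (rule circ_shift_pow_index)
  finally show ?thesis .
qed

text \<open>Linear independence of the rows is that of a family indexed by row numbers: the rows must
  also be pairwise distinct, whence the injectivity.\<close>

definition rows_lin_indpt :: "'a::field mat \<Rightarrow> nat set \<Rightarrow> bool" where
  "rows_lin_indpt A I \<longleftrightarrow>
     inj_on (row A) I \<and> \<not> module.lin_dep class_ring (module_vec TYPE('a) (dim_col A)) (row A ` I)"

end

theory Submission
  imports Defs
begin

text \<open>
  Read a vector of length \<open>n\<close> as a polynomial of degree less than \<open>n\<close>. A circular shift is then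
  multiplication by \<open>X\<close> modulo \<open>f = X^n - 1\<close>, so row \<open>i\<close> of the matrix is the residue of
  \<open>X^i g\<close>, and the combination of the rows whose coefficients are those of a polynomial \<open>p\<close> is
  the residue of \<open>p g\<close> (\<open>circulant_row_relation_iff\<close>). Put \<open>d = gcd(g, f)\<close> and \<open>f = d h\<close>. By
  Bezout, \<open>f\<close> divides \<open>p g\<close> exactly when it divides \<open>p d\<close>, that is, when \<open>h\<close> divides \<open>p\<close>.
  Thus the linear relations between rows are precisely the multiples of \<open>h\<close>, and
  \<open>deg h = n - deg d\<close>.

  A relation between the rows \<open>i, \<dots>, i + r - 1\<close> is a multiple \<open>X^i p\<close> of \<open>h\<close> with \<open>deg p < r\<close>.
  Since \<open>X\<close> is invertible modulo \<open>X^n - 1\<close>, and so modulo \<open>h\<close>, already \<open>h\<close> divides \<open>p\<close>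
  (\<open>dvd_monom_mult_cancel\<close>); as \<open>r \<le> deg h\<close>, this forces \<open>p = 0\<close>.

  The rank is defined through columns, so two facts link it to rows. If the rank were smaller than
  \<open>r\<close>, the first \<open>r\<close> rows would be dependent (\<open>exists_row_relation_if_rank_less\<close>). Conversely,
  \<open>X^i\<close> minus its remainder modulo \<open>h\<close> is a relation, so every row is a combination of the first
  \<open>r\<close> ones; the matrix factors through an \<open>r\<close>-dimensional space, and its rank is at most \<open>r\<close>
  (\<open>rank_mult_le\<close>).
\<close>

section \<open>Column rank and relations between rows\<close>

text \<open>The column space of a product lies in that of the left factor.\<close>

lemma (in vec_space) rank_mult_le:
  assumes B: "B \<in> carrier_mat n k" and C: "C \<in> carrier_mat k nc"
  shows "rank (B * C) \<le> rank B"
proof -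
  have BC: "B * C \<in> carrier_mat n nc" using B C by simp
  have cB: "set (cols B) \<subseteq> carrier_vec n" and cBC: "set (cols (B * C)) \<subseteq> carrier_vec n"
    using cols_dim[of B] cols_dim[of "B * C"] B BC by auto
  have sub: "span (set (cols (B * C))) \<subseteq> span (set (cols B))"
  proof
    fix y assume "y \<in> span (set (cols (B * C)))"
    then obtain x where x: "x \<in> carrier_vec nc" "(B * C) *\<^sub>v x = y" "y \<in> carrier_vec n"
      using col_space_eq[OF BC] carrier_matD[OF BC] unfolding col_space_def by blast
    then have "B *\<^sub>v (C *\<^sub>v x) = y" "C *\<^sub>v x \<in> carrier_vec k"
      using B C by auto
    then show "y \<in> span (set (cols B))"
      using col_space_eq[OF B] carrier_matD[OF B] x(3) unfolding col_space_def by blast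
  qed
  have s: "subspace class_ring (span (set (cols B))) V"
    "subspace class_ring (span (set (cols (B * C)))) V"
    using span_is_subspace cB cBC by auto
  interpret W: vectorspace class_ring "vs (span (set (cols B)))"
    using subspace_is_vs[OF s(1)] .
  have "subspace class_ring (span (set (cols (B * C)))) (vs (span (set (cols B))))"
    using nested_subspaces[OF s sub] .
  from W.subspace_dim[OF this] show ?thesis
    using fin_dim_span_cols[OF B] fin_dim_span_cols[OF BC]
    unfolding rank_def by simp
qed

text \<open>The half of ``row rank equals column rank'' that is needed here. Fewer than \<open>r\<close> columns span the
  column space; restricted to their first \<open>r\<close> coordinates they leave room for a nonzero vector
  orthogonal to all of them, and hence to every column. The coordinates of this vector are the
  coefficients of a relation between the first \<open>r\<close> rows.\<close>

lemma (in vec_space) exists_row_relation_if_rank_less: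
  assumes A: "A \<in> carrier_mat n nc" and less: "rank A < r" and "r \<le> n"
  obtains c i where "i < r" "c i \<noteq> 0" "\<And>j. j < nc \<Longrightarrow> (\<Sum>i<r. c i * A $$ (i, j)) = 0"
proof -
  have cA: "set (cols A) \<subseteq> carrier_vec n" using cols_dim[of A] A by auto
  let ?P = "\<lambda>T. T \<subseteq> set (cols A) \<and> lin_indpt T"
  have "lin_indpt {}" by (rule finite_lin_indpt2) auto
  then have "?P {}" by simp
  then obtain S where S: "finite S" "maximal S ?P"
    using maximal_exists_superset[of "set (cols A)" ?P "{}"] by auto
  then have SA: "S \<subseteq> set (cols A)" and li: "lin_indpt S" by (auto simp: maximal_def)
  have Sc: "S \<subseteq> carrier_vec n" using SA cA by blast
  obtain xs where xs: "set xs = S" "distinct xs"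
    using finite_distinct_list S(1) by blast
  have len: "length xs < r"
    using less rank_card_indpt[OF A S(2)] distinct_card[OF xs(2)] xs(1) by simp
  \<comment> \<open>The spanning columns become the rows of a square matrix. The padding by at least one zero row
    makes it singular, so that its kernel contains the required vector.\<close>
  define B where "B = mat r r (\<lambda>(l, i). if l < length xs then xs ! l $ i else 0)"
  have B: "B \<in> carrier_mat r r" by (simp add: B_def)
  have "row B (length xs) = 0\<^sub>v r"
    using len by (intro eq_vecI) (auto simp: B_def)
  then have "B = mat\<^sub>r r r (\<lambda>l. if l = length xs then 0\<^sub>v r else row B l)"
    using B by (intro eq_matI) (auto simp flip: index_row)
  moreover have "row B \<in> {0..<r} \<rightarrow> carrier_vec r"
    using B by auto
  ultimately have "det B = 0"
    using det_row_0[OF len, of "row B"] by argo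
  then obtain v where v: "v \<in> carrier_vec r" "v \<noteq> 0\<^sub>v r" "B *\<^sub>v v = 0\<^sub>v r"
    using det_0_iff_vec_prod_zero[OF B] by blast
  from v obtain i where i: "i < r" "v $ i \<noteq> 0" by (auto simp: vec_eq_iff)
  have orth: "(\<Sum>i<r. v $ i * x $ i) = 0" if "x \<in> S" for x
  proof -
    from that xs obtain l where l: "l < length xs" "xs ! l = x" by (auto simp: in_set_conv_nth)
    then have "l < r" using len by simp
    then have "(B *\<^sub>v v) $ l = 0" using v by simp
    moreover have "(B *\<^sub>v v) $ l = (\<Sum>i<r. x $ i * v $ i)"
      using v(1) l \<open>l < r\<close> by (simp add: B_def scalar_prod_def lessThan_atLeast0)
    ultimately show ?thesis by (simp add: mult.commute)
  qed
  have "(\<Sum>i<r. v $ i * A $$ (i, j)) = 0" if j: "j < nc" for j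
  proof -
    have colj: "col A j \<in> set (cols A)" using j A by (simp add: cols_def)
    have "col A j \<in> span S"
    proof (rule ccontr)
      assume ns: "col A j \<notin> span S"
      then have nin: "col A j \<notin> S" using span_mem[OF Sc] by blast
      then have "lin_indpt (insert (col A j) S)"
        using ns lin_dep_iff_in_span[OF Sc li, of "col A j"] colj cA by auto
      then show False
        using S(2) SA colj nin unfolding maximal_def by blast
    qed
    then obtain a where a: "col A j = lincomb a S"
      using finite_span[OF S(1) Sc] by auto
    have "A $$ (i, j) = (\<Sum>x\<in>S. a x * x $ i)" if "i < r" for i
    proof -
      have "i < n" using that \<open>r \<le> n\<close> by simp
      then have "A $$ (i, j) = col A j $ i" using A j by simp
      then show ?thesis using lincomb_index[OF \<open>i < n\<close> Sc, of a] a by simp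
    qed
    then have "(\<Sum>i<r. v $ i * A $$ (i, j)) = (\<Sum>i<r. \<Sum>x\<in>S. a x * (v $ i * x $ i))"
      by (intro sum.cong) (auto simp: sum_distrib_left mult_ac)
    also have "\<dots> = (\<Sum>x\<in>S. a x * (\<Sum>i<r. v $ i * x $ i))"
      by (subst sum.swap) (simp add: sum_distrib_left)
    also have "\<dots> = 0" using orth by simp
    finally show ?thesis .
  qed
  then show thesis using that[of i "\<lambda>i. v $ i"] i by blast
qed

text \<open>The premise also makes the rows distinct, since two equal rows give a relation with
  coefficients \<open>1\<close> and \<open>-1\<close>.\<close>

lemma rows_lin_indptI:
  fixes A :: "'a::field mat"
  assumes A: "A \<in> carrier_mat m n" and I: "I \<subseteq> {..<m}"
    and indep: "\<And>c i. (\<And>j. j < n \<Longrightarrow> (\<Sum>i\<in>I. c i * A $$ (i, j)) = 0) \<Longrightarrow> i \<in> I \<Longrightarrow> c i = 0"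
  shows "rows_lin_indpt A I"
proof -
  have finI: "finite I" using I finite_subset by blast
  have row: "row A i $ j = A $$ (i, j)" if "i \<in> I" "j < n" for i j
    using that A I by auto
  have inj: "inj_on (row A) I"
  proof (rule inj_onI, rule ccontr)
    fix a b assume ab: "a \<in> I" "b \<in> I" "row A a = row A b" "a \<noteq> b"
    let ?c = "\<lambda>i. (if i = a then 1 else 0) - (if i = b then 1 else 0) :: 'a"
    have "(\<Sum>i\<in>I. ?c i * A $$ (i, j)) = 0" if "j < n" for j
    proof -
      have "(\<Sum>i\<in>I. ?c i * A $$ (i, j)) =
          (\<Sum>i\<in>I. (if i = a then A $$ (i, j) else 0)) - (\<Sum>i\<in>I. (if i = b then A $$ (i, j) else 0))"
        unfolding sum_subtractf[symmetric] by (intro sum.cong) auto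
      also have "\<dots> = A $$ (a, j) - A $$ (b, j)" using finI ab by simp
      also have "\<dots> = 0" using row[of a j] row[of b j] ab that by simp
      finally show ?thesis .
    qed
    from indep[of ?c a, OF this ab(1)] ab(4) show False by simp
  qed
  interpret vec_space "TYPE('a)" n .
  have rc: "row A ` I \<subseteq> carrier_vec n" using A by auto
  have "lin_indpt (row A ` I)"
  proof (rule finite_lin_indpt2)
    fix a assume 0: "lincomb a (row A ` I) = 0\<^sub>v n"
    have "(\<Sum>i\<in>I. a (row A i) * A $$ (i, j)) = 0" if "j < n" for j
    proof -
      have "(\<Sum>i\<in>I. a (row A i) * A $$ (i, j)) = (\<Sum>i\<in>I. a (row A i) * row A i $ j)"
        using row that by simp
      also have "\<dots> = lincomb a (row A ` I) $ j"
        using lincomb_index[OF that rc, of a] by (simp add: sum.reindex[OF inj])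
      finally show ?thesis using 0 that by simp
    qed
    then show "\<forall>v\<in>row A ` I. a v = 0" using indep[of "\<lambda>i. a (row A i)"] by blast
  qed (use finI rc in auto)
  then show ?thesis using inj A unfolding rows_lin_indpt_def by simp
qed

section \<open>Polynomial divisibility\<close>

text \<open>The Euclidean algorithm, carrying the coefficients along: a combination of \<open>q\<close> and \<open>p mod q\<close> is
  one of \<open>p\<close> and \<open>q\<close>.\<close>

lemma exists_bezout_common_divisor:
  "\<exists>a b. a * p + b * q dvd p \<and> a * p + b * q dvd q" for p q :: "'a::field poly"
proof (induction "euclidean_size q" arbitrary: p q rule: less_induct)
  case less
  show ?case
  proof (cases "q = 0")
    case True
    then show ?thesis by (intro exI[of _ 1] exI[of _ 0]) simp
  next
    case False
    then obtain a b where
      ab: "a * q + b * (p mod q) dvd q" "a * q + b * (p mod q) dvd p mod q"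
      using less[OF mod_size_less[of q p]] by blast
    have "b * p + (a - b * s) * q = a * q + b * (p - s * q)" for s
      by (simp add: algebra_simps)
    from this[of "p div q"] have eq: "b * p + (a - b * (p div q)) * q = a * q + b * (p mod q)"
      by (simp add: minus_div_mult_eq_mod)
    have "a * q + b * (p mod q) dvd p" using ab dvd_mod_iff by blast
    then show ?thesis
      using ab by (intro exI[of _ b] exI[of _ "a - b * (p div q)"]) (simp add: eq)
  qed
qed

text \<open>Modulo \<open>q\<close>, Bezout makes \<open>poly_gcd p q\<close> a multiple of \<open>p\<close>, and \<open>p\<close> is a multiple of
  \<open>poly_gcd p q\<close>; so both have the same annihilators.\<close>

lemma dvd_mult_iff_dvd_mult_poly_gcd:
  "q dvd c * p \<longleftrightarrow> q dvd c * poly_gcd p q" for p q c :: "'a::field poly"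
proof
  obtain a b where ab: "a * p + b * q dvd p" "a * p + b * q dvd q"
    using exists_bezout_common_divisor by blast
  then have "a * p + b * q dvd poly_gcd p q"
    using is_poly_gcd_poly_gcd[of p q] by (simp add: is_poly_gcd_def)
  then obtain k where k: "poly_gcd p q = (a * p + b * q) * k" ..
  assume "q dvd c * p"
  then have "q dvd k * a * (c * p) + c * k * b * q" by simp
  then show "q dvd c * poly_gcd p q" by (simp add: k algebra_simps)
next
  assume "q dvd c * poly_gcd p q"
  moreover have "poly_gcd p q dvd p"
    using is_poly_gcd_poly_gcd[of p q] by (simp add: is_poly_gcd_def)
  ultimately show "q dvd c * p" by (meson dvd_trans dvd_refl mult_dvd_mono)
qed

lemma degree_monom_minus_1:
  assumes "n > 0"
  shows "degree (monom 1 n - 1 :: 'a::field poly) = n"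
  using assms degree_add_eq_left[of "- 1" "monom 1 n :: 'a poly"]
  by (simp add: degree_monom_eq)

text \<open>Modulo a divisor of \<open>X^n - 1\<close>, the polynomial \<open>X\<close> is invertible with inverse \<open>X^(n-1)\<close>. This is
  why the position of a block of rows does not matter.\<close>

lemma dvd_monom_mult_cancel:
  fixes h p :: "'a::field poly"
  assumes h: "h dvd monom 1 n - 1" and "n > 0" and "h dvd monom 1 i * p"
  shows "h dvd p"
  using assms(3)
proof (induction i)
  case 0
  then show ?case by (simp add: monom_0 flip: one_pCons)
next
  case (Suc i)
  have "monom 1 (n - 1) * monom 1 (Suc i) = (monom 1 n * monom 1 i :: 'a poly)"
    using \<open>n > 0\<close> by (simp add: mult_monom)
  then have "monom 1 (n - 1) * (monom 1 (Suc i) * p) = monom 1 n * (monom 1 i * p)"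
    by (metis mult.assoc)
  then have "monom 1 i * p =
      monom 1 (n - 1) * (monom 1 (Suc i) * p) - (monom 1 n - 1) * (monom 1 i * p)"
    by (simp only: left_diff_distrib) simp
  moreover have "h dvd monom 1 (n - 1) * (monom 1 (Suc i) * p)"
    using Suc.prems by (rule dvd_mult)
  moreover have "h dvd (monom 1 n - 1) * (monom 1 i * p)" using h by (rule dvd_mult2)
  ultimately have "h dvd monom 1 i * p" by (metis dvd_diff)
  then show ?case by (rule Suc.IH)
qed

section \<open>Rows of a circulant matrix as residues modulo X^n - 1\<close>

abbreviation poly_of_vec :: "'a::zero vec \<Rightarrow> 'a poly" where
  "poly_of_vec v \<equiv> Poly (list_of_vec v)"

lemma coeff_poly_of_vec: "coeff (poly_of_vec v) j = (if j < dim_vec v then v $ j else 0)"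
  by (simp add: nth_default_def list_of_vec_index)

text \<open>Multiplication by \<open>X\<close> moves the last entry to degree \<open>n\<close>; the subtracted multiple of \<open>X^n - 1\<close>
  brings it back to degree \<open>0\<close>.\<close>

lemma poly_of_vec_circ_shift:
  fixes v :: "'a::field vec"
  assumes "dim_vec v > 0"
  shows "poly_of_vec (circ_shift v) =
    monom 1 1 * poly_of_vec v - Polynomial.smult (v $ (dim_vec v - 1)) (monom 1 (dim_vec v) - 1)"
proof (rule poly_eqI)
  fix j
  show "coeff (poly_of_vec (circ_shift v)) j =
    coeff (monom 1 1 * poly_of_vec v - Polynomial.smult (v $ (dim_vec v - 1)) (monom 1 (dim_vec v) - 1)) j"
    using assms
    by (cases j) (auto simp: coeff_poly_of_vec coeff_monom_mult dim_circ_shift circ_shift_index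
        intro!: arg_cong[where f = "($) v"] simp del: coeff_Poly_eq)
qed

lemma poly_of_vec_circ_shift_pow_cong:
  fixes v :: "'a::field vec"
  assumes "dim_vec v > 0"
  shows "monom 1 (dim_vec v) - 1 dvd poly_of_vec ((circ_shift ^^ i) v) - monom 1 i * poly_of_vec v"
proof (induction i)
  case 0
  then show ?case by (simp add: monom_0 flip: one_pCons)
next
  case (Suc i)
  let ?w = "(circ_shift ^^ i) v"
  have "poly_of_vec ((circ_shift ^^ Suc i) v) - monom 1 (Suc i) * poly_of_vec v =
      monom 1 1 * (poly_of_vec ?w - monom 1 i * poly_of_vec v)
        - Polynomial.smult (?w $ (dim_vec v - 1)) (monom 1 (dim_vec v) - 1)"
    using poly_of_vec_circ_shift[of ?w] assms
    by (simp add: dim_circ_shift_pow right_diff_distrib mult_monom mult.assoc[symmetric])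
  then show ?case using Suc by (simp add: dvd_diff dvd_smult)
qed

text \<open>The combination of the rows with the coefficients of \<open>p\<close> is the polynomial of degree less than
  \<open>n\<close> that is congruent to \<open>p * g\<close> modulo \<open>X^n - 1\<close>; a polynomial of such degree vanishes as soon
  as \<open>X^n - 1\<close> divides it.\<close>

lemma circulant_row_relation_iff:
  fixes g p :: "'a::field poly"
  assumes "n > 0" and "degree g < n" and p: "\<And>i. i \<ge> m \<Longrightarrow> coeff p i = 0"
  shows "(\<forall>j<n. (\<Sum>i<m. coeff p i * gen_circulant m n g $$ (i, j)) = 0)
    \<longleftrightarrow> monom 1 n - 1 dvd p * g"
proof -
  define \<rho> where "\<rho> i = poly_of_vec ((circ_shift ^^ i) (vec n (coeff g)))" for i
  define s where "s = (\<Sum>i<m. Polynomial.smult (coeff p i) (\<rho> i))"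
  have g: "poly_of_vec (vec n (coeff g)) = g"
    using \<open>degree g < n\<close>
    by (intro poly_eqI, unfold coeff_poly_of_vec) (auto simp: coeff_eq_0)
  have "coeff (\<rho> i) j = (if j < n then gen_circulant m n g $$ (i, j) else 0)" if "i < m" for i j
    using that unfolding \<rho>_def coeff_poly_of_vec
    by (simp add: dim_circ_shift_pow circ_shift_pow_index gen_circulant_index)
  then have coeff_s: "coeff s j =
      (if j < n then \<Sum>i<m. coeff p i * gen_circulant m n g $$ (i, j) else 0)" for j
    by (simp add: s_def coeff_sum)
  have "p = (\<Sum>i<m. monom (coeff p i) i)"
    using p by (intro poly_eqI) (simp add: coeff_sum not_less)
  then have "p * g = (\<Sum>i<m. monom (coeff p i) i * g)" by (metis sum_distrib_right)
  then have "s - p * g = (\<Sum>i<m. Polynomial.smult (coeff p i) (\<rho> i - monom 1 i * g))"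
    by (simp add: s_def sum_subtractf smult_diff_right smult_monom flip: mult_smult_left)
  moreover have "monom 1 n - 1 dvd \<rho> i - monom 1 i * g" for i
    using poly_of_vec_circ_shift_pow_cong[of "vec n (coeff g)" i] \<open>n > 0\<close> g
    by (simp add: \<rho>_def)
  ultimately have "monom 1 n - 1 dvd s - p * g"
    by (simp add: dvd_sum dvd_smult)
  then have "monom 1 n - 1 dvd p * g \<longleftrightarrow> monom 1 n - 1 dvd s"
    by (metis dvd_diff_right_iff diff_diff_eq2 dvd_add_right_iff dvd_diff_left_iff)
  also have "\<dots> \<longleftrightarrow> s = 0"
  proof
    assume dvd: "monom 1 n - 1 dvd s"
    show "s = 0"
    proof (rule ccontr)
      assume "s \<noteq> 0"
      then have "n \<le> degree s"
        using dvd_imp_degree_le[OF dvd] degree_monom_minus_1[OF \<open>n > 0\<close>, where 'a = 'a] by simp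
      then have "lead_coeff s = 0" by (simp add: coeff_s)
      then show False using \<open>s \<noteq> 0\<close> by simp
    qed
  qed simp
  also have "\<dots> \<longleftrightarrow> (\<forall>j<n. (\<Sum>i<m. coeff p i * gen_circulant m n g $$ (i, j)) = 0)"
    by (auto simp: poly_eq_iff coeff_s)
  finally show ?thesis by blast
qed

section \<open>Rank and independence of consecutive rows\<close>

theorem corollary2p5:
  fixes m n r :: nat and g :: "'a::field poly"
  assumes "m > 0" and "n > 0"
    and "CHAR('a) = 0 \<or> coprime CHAR('a) n"
    and "degree g < n"
    and "r = min m (n - degree (poly_gcd g (monom 1 n - 1)))"
  shows "vec_space.rank m (gen_circulant m n g) = r \<and>
    (\<forall>i. i + r \<le> m \<longrightarrow> rows_lin_indpt (gen_circulant m n g) {i..<i + r})"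
proof -
  let ?A = "gen_circulant m n g"
  let ?f = "monom 1 n - 1 :: 'a poly"
  define d where "d = poly_gcd g ?f"
  have A: "?A \<in> carrier_mat m n" by (rule gen_circulant_carrier)
  have degf: "degree ?f = n" using degree_monom_minus_1 \<open>n > 0\<close> .
  then have f0: "?f \<noteq> 0" using \<open>n > 0\<close> by auto
  have "d dvd ?f"
    using is_poly_gcd_poly_gcd[of g ?f] by (simp add: is_poly_gcd_def d_def)
  then obtain h where h: "?f = d * h" ..
  then have d0: "d \<noteq> 0" and h0: "h \<noteq> 0" using f0 by auto
  then have "n = degree d + degree h" using h degf by (metis degree_mult_eq)
  then have r: "r = min m (degree h)" using assms(5) by (simp add: d_def)
  then have rm: "r \<le> m" by simp
  \<comment> \<open>The relations between rows are the multiples of \<open>h\<close>.\<close>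
  have relation_iff: "(\<forall>j<n. (\<Sum>i<m. coeff p i * ?A $$ (i, j)) = 0) \<longleftrightarrow> h dvd p"
    if "\<And>i. i \<ge> m \<Longrightarrow> coeff p i = 0" for p
  proof -
    have "?f dvd p * g \<longleftrightarrow> ?f dvd p * d"
      unfolding d_def by (rule dvd_mult_iff_dvd_mult_poly_gcd)
    also have "\<dots> \<longleftrightarrow> d * h dvd d * p"
      unfolding h by (simp only: mult.commute)
    finally have "?f dvd p * g \<longleftrightarrow> d * h dvd d * p" .
    then show ?thesis
      using circulant_row_relation_iff[OF \<open>n > 0\<close> \<open>degree g < n\<close> that] d0 by simp
  qed
  have indep: "c l = 0"
    if ir: "i + r \<le> m" and zero: "\<And>j. j < n \<Longrightarrow> (\<Sum>l\<in>{i..<i + r}. c l * ?A $$ (l, j)) = 0"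
      and l: "l \<in> {i..<i + r}" for i l c
  proof -
    \<comment> \<open>The relation shifted down to the rows from \<open>0\<close> on, so that its degree is less than \<open>r\<close>.\<close>
    define p where "p = (\<Sum>k<r. monom (c (i + k)) k)"
    have coeff_p: "coeff p k = (if k < r then c (i + k) else 0)" for k
      by (simp add: p_def coeff_sum)
    have coeff_ip: "coeff (monom 1 i * p) k = (if k \<in> {i..<i + r} then c k else 0)" for k
      by (auto simp: coeff_monom_mult coeff_p)
    have "(\<Sum>k<m. coeff (monom 1 i * p) k * ?A $$ (k, j)) =
        (\<Sum>k\<in>{i..<i + r}. c k * ?A $$ (k, j))" for j
      using ir by (intro sum.mono_neutral_cong_right) (auto simp: coeff_ip)
    then have "h dvd monom 1 i * p"
      using relation_iff[of "monom 1 i * p"] zero ir by (simp add: coeff_ip)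
    moreover have "h dvd ?f" unfolding h by simp
    ultimately have "h dvd p" using dvd_monom_mult_cancel \<open>n > 0\<close> by blast
    have "p = 0"
    proof (rule ccontr)
      assume "p \<noteq> 0"
      then have "degree h \<le> degree p" using \<open>h dvd p\<close> dvd_imp_degree_le by blast
      then have "lead_coeff p = 0" using r by (simp add: coeff_p)
      then show False using \<open>p \<noteq> 0\<close> by simp
    qed
    moreover have "l - i < r" "i + (l - i) = l" using l by auto
    ultimately show "c l = 0" using coeff_p[of "l - i"] by simp
  qed
  have rank_ge: "r \<le> vec_space.rank m ?A"
  proof (rule ccontr)
    assume "\<not> r \<le> vec_space.rank m ?A"
    then have less: "vec_space.rank m ?A < r" by simp
    obtain c i where ci: "i < r" "c i \<noteq> 0"
      and zero: "\<And>j. j < n \<Longrightarrow> (\<Sum>i<r. c i * ?A $$ (i, j)) = 0"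
      using vec_space.exists_row_relation_if_rank_less[OF A less rm] by blast
    have "c i = 0"
      by (rule indep[of 0]) (use rm ci zero in \<open>auto simp: atLeast0LessThan\<close>)
    then show False using ci by simp
  qed
  have rank_le: "vec_space.rank m ?A \<le> r"
  proof -
    \<comment> \<open>Row \<open>i\<close> of \<open>B\<close> expresses row \<open>i\<close> of the matrix through the first \<open>r\<close> rows: the remainder of
      \<open>X^i\<close> modulo \<open>h\<close> differs from \<open>X^i\<close> by a relation.\<close>
    define B where "B = mat m r (\<lambda>(i, l). coeff (monom 1 i mod h) l)"
    define R where "R = mat r n (($$) ?A)"
    have B: "B \<in> carrier_mat m r" and R: "R \<in> carrier_mat r n" by (simp_all add: B_def R_def)
    have "?A = B * R"
    proof (rule eq_matI)
      fix i j assume "i < dim_row (B * R)" "j < dim_col (B * R)"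
      then have ij: "i < m" "j < n" by (auto simp: B_def R_def)
      let ?X = "monom 1 i :: 'a poly"
      have mod0: "coeff (?X mod h) l = 0" if "l \<ge> r" for l
      \<comment> \<open>If \<open>r = m\<close>, then \<open>X^i\<close> is its own remainder; otherwise \<open>r = deg h\<close> bounds the remainder.\<close>
      proof (cases "m \<le> degree h")
        case True
        then have "degree ?X < degree h" using ij by (simp add: degree_monom_eq)
        then have "?X mod h = ?X" by (rule mod_poly_less)
        then show ?thesis using that True r ij by simp
      next
        case False
        then show ?thesis
          using degree_mod_less[OF h0, of ?X] that r by (auto intro: coeff_eq_0)
      qed
      have "h dvd ?X - ?X mod h" by (simp add: dvd_minus_mod)
      then have "(\<Sum>l<m. coeff (?X - ?X mod h) l * ?A $$ (l, j)) = 0"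
        using relation_iff[of "?X - ?X mod h"] mod0 r ij by simp
      moreover have "(\<Sum>l<m. coeff ?X l * ?A $$ (l, j)) = (\<Sum>l<m. if l = i then ?A $$ (l, j) else 0)"
        by (intro sum.cong) auto
      moreover have "(\<Sum>l<m. coeff (?X mod h) l * ?A $$ (l, j)) =
          (\<Sum>l<r. coeff (?X mod h) l * ?A $$ (l, j))"
        using r mod0 by (intro sum.mono_neutral_right) auto
      ultimately have "?A $$ (i, j) = (\<Sum>l<r. coeff (?X mod h) l * ?A $$ (l, j))"
        using ij by (simp add: left_diff_distrib sum_subtractf)
      also have "\<dots> = (B * R) $$ (i, j)"
        using ij by (simp add: B_def R_def scalar_prod_def lessThan_atLeast0)
      finally show "?A $$ (i, j) = (B * R) $$ (i, j)" .
    qed (use A B R in auto)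
    then show ?thesis
      using vec_space.rank_mult_le[OF B R] vec_space.rank_le_nc[OF B] by simp
  qed
  have "rows_lin_indpt ?A {i..<i + r}" if "i + r \<le> m" for i
    using that indep[OF that] by (intro rows_lin_indptI[OF A]) auto
  then show ?thesis using rank_ge rank_le by simp
qed

end
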